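(* Let $\{\mathbf{a}_1,\dots,\mathbf{a}_s\}\subset\mathbb{Z}^m$ be an arbitrary set of vectors. Let $\mathbf{c}_1,\dots,\mathbf{c}_s$ be any primitive vectors, with $\mathbf{c}_i\in\mathbb{Z}^{m_i}$ for some $m_i\ge 1$, each having full support and a positive first coordinate. Put $p=m+\sum_{i=1}^s(m_i-1)$ and $q=\sum_{i=1}^s m_i$. Then there exists a matrix $A\in\mathbb{Z}^{p\times q}$ with a subbouquet decomposition $B_1,\dots,B_s$ such that, for each $i$, the subbouquet $B_i$ is encoded by the vectors $$\mathbf{a}_{B_i}=(\mathbf{a}_i,\mathbf{0},\dots,\mathbf{0})\in\mathbb{Z}^p,\qquad \mathbf{c}_{B_i}=(\mathbf{0},\dots,\mathbf{c}_i,\dots,\mathbf{0})\in\mathbb{Z}^q,$$ where the support of $\mathbf{c}_{B_i}$ is precisely the $i$-th block of $\mathbb{Z}^q=\mathbb{Z}^{m_1}\times\cdots\times\mathbb{Z}^{m_s}$, of size $m_i$.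
   Context: An integer vector is primitive if the gcd of its coordinates is $1$; it has full support if all its coordinates are nonzero. Let $A=[\beta_1,\dots,\beta_q]\in\mathbb{Z}^{p\times q}$. Gale transform: let $r=\operatorname{rank}A$, fix a basis $G_1,\dots,G_{q-r}$ of the lattice $\operatorname{Ker}_{\mathbb{Z}}(A)=\{\mathbf{u}\in\mathbb{Z}^q:A\mathbf{u}=\mathbf{0}\}$, and let $G(\beta_i)\in\mathbb{Z}^{q-r}$ be the $i$-th row of the matrix with columns $G_1,\dots,G_{q-r}$. A co-vector of $A$ is a vector $(\mathbf{v}\cdot\beta_1,\dots,\mathbf{v}\cdot\beta_q)$ with $\mathbf{v}\in\mathbb{Z}^p$; a co-circuit is a nonzero co-vector of minimal support. $\beta_i$ is free if $\{i\}$ is the support of a co-circuit (equivalently $G(\beta_i)=\mathbf{0}$). The bouquet graph $G_A$ has vertices $\beta_1,\dots,\beta_q$ (distinguished by their indices), and $\{\beta_i,\beta_j\}$, $i\neq j$, is an edge if there is a co-vector with support $\{i,j\}$. The bouquets of $A$ are the connected components of $G_A$ (each is a clique); the free vectors, if any, form one bouquet. A subbouquet is an induced subgraph of $G_A$ that is a clique on its (nonempty) set of vertices; it is called free if its vertices are free vectors, and non-free otherwise (then none of its vertices is free). A subbouquet decomposition of $A$ is a family of pairwise vertex-disjoint subbouquets whose vertex sets have union $\{\beta_1,\dots,\beta_q\}$. Encoding vectors of a subbouquet $B$: if $B$ is free, $\mathbf{c}_B\in\mathbb{Z}^q$ may be chosen to be any vector with support $\{i:\beta_i\in B\}$ and positive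 first nonzero coordinate. If $B$ is non-free, the vectors $G(\beta_i)$, $\beta_i\in B$, are nonzero and pairwise linearly dependent; choose a coordinate $j$ in which they are all nonzero, let $g_j=\gcd(G(\beta_i)_j:\beta_i\in B)$, let $i_0$ be the smallest index with $\beta_{i_0}\in B$, let $\varepsilon$ be the sign of $G(\beta_{i_0})_j$, and let $\mathbf{c}_B$ have $i$-th coordinate $\varepsilon G(\beta_i)_j/g_j$ if $\beta_i\in B$ and $0$ otherwise (independent of $j$). In both cases $\mathbf{a}_B=\sum_{i=1}^q(\mathbf{c}_B)_i\beta_i\in\mathbb{Z}^p$. "$B$ is encoded by the vectors $\mathbf{a}_B$, $\mathbf{c}_B$" means that these are its vectors in this sense (for a free $B$: that the given $\mathbf{c}_B$ is an admissible choice and $\mathbf{a}_B$ is the corresponding vector). *)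

theory Defs
  imports "Jordan_Normal_Form.Matrix_Kernel"
begin

text \<open>
  Integer vectors and matrices are those of \<open>Jordan_Normal_Form.Matrix\<close>, with indices starting
  at 0. The vectors \<open>\<beta>\<^sub>i\<close> of a configuration are the columns of a matrix \<open>A\<close>; they are represented
  by their indices \<open>i < dim_col A\<close>, so that equal columns remain distinct vertices.
\<close>

definition primitive_vec :: "int vec \<Rightarrow> bool" where
  "primitive_vec v \<longleftrightarrow> (GCD k\<in>{..<dim_vec v}. v $ k) = 1"

definition vec_support :: "int vec \<Rightarrow> nat set" where
  "vec_support v = {k. k < dim_vec v \<and> v $ k \<noteq> 0}"

definition full_support :: "int vec \<Rightarrow> bool" where
  "full_support v \<longleftrightarrow> (\<forall>k<dim_vec v. v $ k \<noteq> 0)"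

definition covectors :: "int mat \<Rightarrow> int vec set" where
  "covectors A = {transpose_mat A *\<^sub>v v | v. v \<in> carrier_vec (dim_row A)}"

definition cocircuit :: "int mat \<Rightarrow> int vec \<Rightarrow> bool" where
  "cocircuit A w \<longleftrightarrow> w \<in> covectors A \<and> w \<noteq> 0\<^sub>v (dim_col A) \<and>
     (\<forall>w'\<in>covectors A. w' \<noteq> 0\<^sub>v (dim_col A) \<longrightarrow> \<not> vec_support w' \<subset> vec_support w)"

definition free_col :: "int mat \<Rightarrow> nat \<Rightarrow> bool" where
  "free_col A i \<longleftrightarrow> (\<exists>w. cocircuit A w \<and> vec_support w = {i})"

definition bouquet_edge :: "int mat \<Rightarrow> nat \<Rightarrow> nat \<Rightarrow> bool" where
  "bouquet_edge A i j \<longleftrightarrow> i \<noteq> j \<and> (\<exists>w\<in>covectors A. vec_support w = {i, j})"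

text \<open>A subbouquet, being an induced subgraph, is identified with its set of vertices.\<close>

definition subbouquet :: "int mat \<Rightarrow> nat set \<Rightarrow> bool" where
  "subbouquet A B \<longleftrightarrow> B \<noteq> {} \<and> B \<subseteq> {..<dim_col A} \<and> pairwise (bouquet_edge A) B"

definition free_subbouquet :: "int mat \<Rightarrow> nat set \<Rightarrow> bool" where
  "free_subbouquet A B \<longleftrightarrow> subbouquet A B \<and> (\<forall>i\<in>B. free_col A i)"

definition subbouquet_decomposition :: "int mat \<Rightarrow> nat \<Rightarrow> (nat \<Rightarrow> nat set) \<Rightarrow> bool" where
  "subbouquet_decomposition A s B \<longleftrightarrow>
     (\<forall>i<s. subbouquet A (B i)) \<and> disjoint_family_on B {..<s} \<and> (\<Union>i<s. B i) = {..<dim_col A}"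

text \<open>
  The columns of \<open>G\<close> form a \<open>\<int>\<close>-basis of the lattice \<open>Ker\<^sub>\<int>(A)\<close>: taking integer linear combinations
  of the columns is injective (independence) with image the kernel (generation). The number
  \<open>dim_col G\<close> of basis vectors is then necessarily \<open>dim_col A - rank A\<close>. The Gale transform of
  column \<open>i\<close> of \<open>A\<close> is row \<open>i\<close> of \<open>G\<close>.
\<close>

definition gale_matrix :: "int mat \<Rightarrow> int mat \<Rightarrow> bool" where
  "gale_matrix A G \<longleftrightarrow> dim_row G = dim_col A \<and>
     bij_betw (\<lambda>x. G *\<^sub>v x) (carrier_vec (dim_col G)) (mat_kernel A)"

text \<open>
  \<open>encoded_by A G B a c\<close>: the subbouquet \<open>B\<close> of \<open>A\<close> is encoded by \<open>a\<close> and \<open>c\<close>, where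
  the Gale transform is computed from the kernel basis \<open>G\<close>. The vector \<open>A *\<^sub>v c\<close> is the sum of the
  \<open>c\<^sub>i \<beta>\<^sub>i\<close>, and the integer division by the gcd is exact.
\<close>

definition encoded_by :: "int mat \<Rightarrow> int mat \<Rightarrow> nat set \<Rightarrow> int vec \<Rightarrow> int vec \<Rightarrow> bool" where
  "encoded_by A G B a c \<longleftrightarrow>
     c \<in> carrier_vec (dim_col A) \<and> a = A *\<^sub>v c \<and>
     (if free_subbouquet A B then vec_support c = B \<and> c $ Min B > 0
      else \<exists>j<dim_col G. (\<forall>i\<in>B. G $$ (i, j) \<noteq> 0) \<and>
        c = vec (dim_col A) (\<lambda>i. if i \<in> B
              then sgn (G $$ (Min B, j)) * (G $$ (i, j) div (GCD k\<in>B. G $$ (k, j))) else 0))"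

text \<open>Kernel bases always exist, so quantifying over all of them is never vacuous.\<close>

lemma sublattice_basis:
  assumes "L \<subseteq> carrier_vec n" "0\<^sub>v n \<in> L"
    and "\<And>u v. u \<in> L \<Longrightarrow> v \<in> L \<Longrightarrow> u + v \<in> L"
    and "\<And>(t::int) v. v \<in> L \<Longrightarrow> t \<cdot>\<^sub>v v \<in> L"
    and "k \<le> n" "\<And>v i. v \<in> L \<Longrightarrow> k \<le> i \<Longrightarrow> i < n \<Longrightarrow> v $ i = 0"
  shows "\<exists>G. dim_row G = n \<and> bij_betw (\<lambda>x. G *\<^sub>v x) (carrier_vec (dim_col G)) L"
  using assms
proof (induction k arbitrary: L)
  case 0
  have "L = {0\<^sub>v n}"
    using 0 by (fastforce intro!: eq_vecI)
  moreover have "carrier_vec 0 = {vNil :: int vec}"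
    by auto
  moreover have "mat n 0 (\<lambda>_. 0) *\<^sub>v (vNil :: int vec) = 0\<^sub>v n"
    by (intro eq_vecI) (auto simp: scalar_prod_def)
  ultimately have "bij_betw (\<lambda>x. mat n 0 (\<lambda>_. 0) *\<^sub>v x) (carrier_vec 0) L"
    by (simp add: bij_betw_def)
  then show ?case
    by (intro exI[of _ "mat n 0 (\<lambda>_. 0)"]) simp
next
  case (Suc k)
  note car = Suc.prems(1)
  define L' where "L' = {v \<in> L. v $ k = 0}"
  have kn: "k < n" using Suc.prems by simp
  have "\<exists>G. dim_row G = n \<and> bij_betw (\<lambda>x. G *\<^sub>v x) (carrier_vec (dim_col G)) L'"
  proof (rule Suc.IH)
    show "L' \<subseteq> carrier_vec n" using car by (auto simp: L'_def)
    show "0\<^sub>v n \<in> L'" using Suc.prems(2) kn by (auto simp: L'_def)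
    show "u + v \<in> L'" if "u \<in> L'" "v \<in> L'" for u v
    proof -
      have "v \<in> carrier_vec n" using that car by (auto simp: L'_def)
      then show ?thesis using that Suc.prems(3) kn by (auto simp: L'_def)
    qed
    show "t \<cdot>\<^sub>v v \<in> L'" if "v \<in> L'" for t v
    proof -
      have "v \<in> carrier_vec n" using that car by (auto simp: L'_def)
      then show ?thesis using that Suc.prems(4) kn by (auto simp: L'_def)
    qed
    show "k \<le> n" using kn by simp
    show "v $ i = 0" if "v \<in> L'" "k \<le> i" "i < n" for v i
      using that Suc.prems(6)[of v i] by (cases "i = k") (auto simp: L'_def)
  qed
  then obtain G where G: "dim_row G = n"
    and bij: "bij_betw (\<lambda>x. G *\<^sub>v x) (carrier_vec (dim_col G)) L'" by blast
  show ?case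
  proof (cases "L' = L")
    case True
    then show ?thesis using G bij by blast
  next
    case False
    define d where "d = dim_col G"
    define P where "P = (\<lambda>t::nat. t > 0 \<and> (\<exists>v\<in>L. v $ k = int t))"
    obtain w where w: "w \<in> L" "w $ k \<noteq> 0" using False by (auto simp: L'_def)
    have wc: "w \<in> carrier_vec n" using w car by auto
    have "P (nat \<bar>w $ k\<bar>)"
    proof (cases "w $ k > 0")
      case True
      then show ?thesis using w by (auto simp: P_def)
    next
      case False
      have "(-1) \<cdot>\<^sub>v w \<in> L" using Suc.prems(4) w by blast
      moreover have "((-1) \<cdot>\<^sub>v w) $ k = \<bar>w $ k\<bar>" using wc kn False by auto
      ultimately show ?thesis using w by (auto simp: P_def)
    qed
    then have "P (LEAST t. P t)" by (rule LeastI)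
    then obtain t v0 where t: "t = (LEAST t. P t)" "t > 0" and v0: "v0 \<in> L" "v0 $ k = int t"
      by (auto simp: P_def)
    have v0c: "v0 \<in> carrier_vec n" using v0 car by auto
    have dvd: "\<exists>z. u - z \<cdot>\<^sub>v v0 \<in> L'" if u: "u \<in> L" for u
    proof -
      define z where "z = u $ k div int t"
      have uc: "u \<in> carrier_vec n" using u car by auto
      have eq: "u - z \<cdot>\<^sub>v v0 = u + (- z) \<cdot>\<^sub>v v0" using uc v0c by (intro eq_vecI) auto
      have inL: "u - z \<cdot>\<^sub>v v0 \<in> L" unfolding eq using u v0 Suc.prems(3,4) by blast
      have val: "(u - z \<cdot>\<^sub>v v0) $ k = u $ k mod int t"
        using uc v0c kn v0 by (simp add: z_def minus_div_mult_eq_mod)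
      have "u $ k mod int t = 0"
      proof (rule ccontr)
        assume ne: "u $ k mod int t \<noteq> 0"
        have "u $ k mod int t \<ge> 0" using t by simp
        then have "P (nat (u $ k mod int t))"
          using inL val ne by (auto simp: P_def intro!: bexI[of _ "u - z \<cdot>\<^sub>v v0"])
        then have "t \<le> nat (u $ k mod int t)" unfolding t(1) by (rule Least_le)
        moreover have "u $ k mod int t < int t" using t by simp
        ultimately show False using \<open>u $ k mod int t \<ge> 0\<close> by linarith
      qed
      then show ?thesis using inL val by (auto simp: L'_def)
    qed
    define H where "H = mat n (Suc d) (\<lambda>(i, j). if j < d then G $$ (i, j) else v0 $ i)"
    have H: "H *\<^sub>v x = G *\<^sub>v vec d (\<lambda>j. x $ j) + x $ d \<cdot>\<^sub>v v0" if "x \<in> carrier_vec (Suc d)" for x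
      using that v0c G
      by (intro eq_vecI) (auto simp: H_def scalar_prod_def d_def sum.atLeast0_lessThan_Suc mult.commute)
    have GL: "G *\<^sub>v y \<in> L'" if "y \<in> carrier_vec d" for y
      using bij that by (auto simp: bij_betw_def d_def)
    have Gk: "(G *\<^sub>v y) $ k = 0" "G *\<^sub>v y \<in> carrier_vec n" if "y \<in> carrier_vec d" for y
      using GL[OF that] car by (auto simp: L'_def)
    have "bij_betw (\<lambda>x. H *\<^sub>v x) (carrier_vec (Suc d)) L"
      unfolding bij_betw_def
    proof
      show "inj_on (\<lambda>x. H *\<^sub>v x) (carrier_vec (Suc d))"
      proof (rule inj_onI)
        fix x y assume x: "x \<in> carrier_vec (Suc d)" and y: "y \<in> carrier_vec (Suc d)"
          and eq: "H *\<^sub>v x = H *\<^sub>v y"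
        let ?x = "vec d (\<lambda>j. x $ j)" and ?y = "vec d (\<lambda>j. y $ j)"
        have xy: "G *\<^sub>v ?x + x $ d \<cdot>\<^sub>v v0 = G *\<^sub>v ?y + y $ d \<cdot>\<^sub>v v0"
          using eq H x y by simp
        have "(G *\<^sub>v ?x + x $ d \<cdot>\<^sub>v v0) $ k = x $ d * int t"
          "(G *\<^sub>v ?y + y $ d \<cdot>\<^sub>v v0) $ k = y $ d * int t"
          using Gk[of ?x] Gk[of ?y] v0c v0(2) kn G by auto
        with xy t have last: "x $ d = y $ d" by auto
        have "G *\<^sub>v ?x = G *\<^sub>v ?y"
        proof (rule eq_vecI)
          fix i assume "i < dim_vec (G *\<^sub>v ?y)"
          then have i: "i < n" using G by simp
          have "(G *\<^sub>v ?x + x $ d \<cdot>\<^sub>v v0) $ i = (G *\<^sub>v ?y + y $ d \<cdot>\<^sub>v v0) $ i" using xy by simp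
          then show "(G *\<^sub>v ?x) $ i = (G *\<^sub>v ?y) $ i" using i G v0c last
            by (simp del: index_mult_mat_vec)
        qed simp
        then have "?x = ?y" using bij by (auto simp: bij_betw_def d_def dest: inj_onD)
        then have "x $ j = y $ j" if "j < d" for j
          using that by (metis index_vec)
        with last x y show "x = y"
          by (intro eq_vecI) (auto simp: less_Suc_eq)
      qed
      show "(\<lambda>x. H *\<^sub>v x) ` carrier_vec (Suc d) = L"
      proof (intro equalityI subsetI)
        fix u assume "u \<in> (\<lambda>x. H *\<^sub>v x) ` carrier_vec (Suc d)"
        then obtain x where x: "x \<in> carrier_vec (Suc d)" "u = H *\<^sub>v x" by blast
        have "G *\<^sub>v vec d (\<lambda>j. x $ j) \<in> L" using GL[of "vec d (\<lambda>j. x $ j)"] by (auto simp: L'_def)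
        then show "u \<in> L" using x H v0 Suc.prems(3,4) by auto
      next
        fix u assume u: "u \<in> L"
        then have uc: "u \<in> carrier_vec n" using car by auto
        obtain z where "u - z \<cdot>\<^sub>v v0 \<in> L'" using dvd u by blast
        then obtain y where y: "y \<in> carrier_vec d" "G *\<^sub>v y = u - z \<cdot>\<^sub>v v0"
          using bij by (auto simp: bij_betw_def d_def image_iff)
        define x where "x = vec (Suc d) (\<lambda>j. if j < d then y $ j else z)"
        have "vec d (\<lambda>j. x $ j) = y" "x $ d = z" using y by (auto simp: x_def)
        then have "H *\<^sub>v x = u - z \<cdot>\<^sub>v v0 + z \<cdot>\<^sub>v v0" using H[of x] y by (simp add: x_def)
        also have "\<dots> = u" using uc v0c by (intro eq_vecI) auto
        finally show "u \<in> (\<lambda>x. H *\<^sub>v x) ` carrier_vec (Suc d)"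
          by (auto simp: x_def intro!: image_eqI[of _ _ x])
      qed
    qed
    then show ?thesis by (intro exI[of _ H]) (simp add: H_def)
  qed
qed

lemma gale_matrix_exists: "\<exists>G. gale_matrix A G"
proof -
  let ?n = "dim_col A"
  have car: "mat_kernel A \<subseteq> carrier_vec ?n" by (auto simp: mat_kernel_def)
  have "\<exists>G. dim_row G = ?n \<and> bij_betw (\<lambda>x. G *\<^sub>v x) (carrier_vec (dim_col G)) (mat_kernel A)"
  proof (rule sublattice_basis[where k = ?n])
    show "0\<^sub>v ?n \<in> mat_kernel A"
      by (auto simp: mat_kernel_def intro!: eq_vecI)
    have A: "A \<in> carrier_mat (dim_row A) ?n" by simp
    show "u + v \<in> mat_kernel A" if "u \<in> mat_kernel A" "v \<in> mat_kernel A" for u v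
      using that mult_add_distrib_mat_vec[OF A, of u v] by (auto simp: mat_kernel_def)
    show "t \<cdot>\<^sub>v v \<in> mat_kernel A" if "v \<in> mat_kernel A" for t v
    proof -
      have "v \<in> carrier_vec ?n" "A *\<^sub>v v = 0\<^sub>v (dim_row A)"
        using that by (auto simp: mat_kernel_def)
      moreover have "A *\<^sub>v (t \<cdot>\<^sub>v v) = t \<cdot>\<^sub>v (A *\<^sub>v v)"
        using \<open>v \<in> carrier_vec ?n\<close>
        by (intro eq_vecI) (auto simp: scalar_prod_def sum_distrib_left mult.left_commute)
      ultimately show ?thesis by (auto simp: mat_kernel_def)
    qed
  qed (use car in auto)
  then show ?thesis by (simp add: gale_matrix_def)
qed

end

theory Submission
  imports Defs
begin

text \<open>
  Since \<open>c\<^sub>i\<close> is primitive, there are integers \<open>\<lambda>\<^sub>i\<^sub>l\<close> with \<open>\<Sum>\<^sub>l \<lambda>\<^sub>i\<^sub>l c\<^sub>i\<^sub>l = 1\<close>. The matrix \<open>A\<close> consists of an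
  upper part, whose column in position \<open>l\<close> of block \<open>i\<close> is \<open>\<lambda>\<^sub>i\<^sub>l a\<^sub>i\<close>, and of a lower part with one row
  for each position \<open>l > 0\<close> of each block \<open>i\<close>. That row expresses the equation
  \<open>c\<^sub>i\<^sub>0 u\<^sub>l = c\<^sub>i\<^sub>l u\<^sub>0\<close> between two coordinates of block \<open>i\<close>.

  The lower rows are covectors with two-element support \<open>{0, l}\<close> inside a block, and eliminating the
  leading position between two of them gives a covector with support \<open>{k, l}\<close>. Hence every block is
  a subbouquet. The lower part kills \<open>c\<^sub>i\<close>, while the upper part sends it to
  \<open>(\<Sum>\<^sub>l \<lambda>\<^sub>i\<^sub>l c\<^sub>i\<^sub>l) a\<^sub>i = a\<^sub>i\<close>; this is the first half of the encoding.

  For the second half, the lower equations force a kernel vector to be proportional to \<open>c\<^sub>i\<close> on block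
  \<open>i\<close>, and the relation \<open>\<Sum>\<^sub>l \<lambda>\<^sub>i\<^sub>l c\<^sub>i\<^sub>l = 1\<close> makes the factor an integer
  (\<open>kernel_block_multiple\<close>). So on block \<open>i\<close> each column of a Gale matrix is \<open>t c\<^sub>i\<close> with an integer
  \<open>t\<close>; if \<open>t \<noteq> 0\<close>, dividing by the gcd \<open>\<bar>t\<bar>\<close> and normalising the sign recovers \<open>c\<^sub>i\<close>. A column of the
  Gale matrix with \<open>t \<noteq> 0\<close> exists as soon as some column in the block is not free. This is the
  duality between covectors and the kernel: a column index at which the whole kernel vanishes is the
  support of a covector (\<open>kernel_vector_or_singleton_covector\<close>). It follows from a form of the
  Fredholm alternative over an integral domain, \<open>separating_functional_or_relation\<close>.
\<close>

section \<open>Integer linear algebra\<close>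

lemma GCD_eq_int_combination:
  fixes f :: "'k \<Rightarrow> int"
  assumes "finite S"
  shows "\<exists>g. (\<Sum>k\<in>S. g k * f k) = (GCD k\<in>S. f k)"
  using assms
proof (induction S rule: finite_induct)
  case (insert x S)
  then obtain g where g: "(\<Sum>k\<in>S. g k * f k) = (GCD k\<in>S. f k)" by blast
  obtain u v where uv: "u * f x + v * (GCD k\<in>S. f k) = gcd (f x) (GCD k\<in>S. f k)"
    using bezout_int by blast
  let ?h = "\<lambda>k. if k = x then u else v * g k"
  have "(\<Sum>k\<in>S. ?h k * f k) = (\<Sum>k\<in>S. v * (g k * f k))"
    using insert.hyps by (intro sum.cong) auto
  then have "(\<Sum>k\<in>insert x S. ?h k * f k) = u * f x + v * (\<Sum>k\<in>S. g k * f k)"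
    using insert.hyps by (simp add: sum_distrib_left)
  then show ?case using g uv by auto
qed simp

text \<open>
  Induction on the family, for all targets \<open>b\<close> at once. When \<open>x i\<close> joins the family and is itself
  dependent on the old vectors, a functional vanishing on those vanishes on \<open>x i\<close> too. Otherwise some
  \<open>w\<close> vanishes on the old vectors but not on \<open>x i\<close>; then the induction hypothesis is applied to the
  combination \<open>(w \<bullet> x i) b - (w \<bullet> b) x i\<close>, the fraction-free projection of \<open>b\<close> along \<open>x i\<close> into the
  kernel of \<open>w\<close>. A relation for the projection is one for \<open>b\<close>, and a functional for it becomes one for
  \<open>b\<close> after the analogous fraction-free correction by \<open>w\<close>.
\<close>

lemma separating_functional_or_relation:
  fixes x :: "'j \<Rightarrow> 'r \<Rightarrow> 'a :: idom"
  assumes "finite R" "finite S"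
  shows "(\<exists>v. (\<forall>j\<in>S. (\<Sum>r\<in>R. v r * x j r) = 0) \<and> (\<Sum>r\<in>R. v r * b r) \<noteq> 0)
    \<or> (\<exists>t h. t \<noteq> 0 \<and> (\<forall>r\<in>R. t * b r = (\<Sum>j\<in>S. h j * x j r)))"
  using assms(2)
proof (induction S arbitrary: b rule: finite_induct)
  case empty
  show ?case
  proof (cases "\<forall>r\<in>R. b r = 0")
    case True
    then show ?thesis by (intro disjI2 exI[of _ 1]) auto
  next
    case False
    then obtain r0 where r0: "r0 \<in> R" "b r0 \<noteq> 0" by blast
    have "(\<Sum>r\<in>R. of_bool (r = r0) * b r) = (\<Sum>r\<in>R. if r = r0 then b r else 0)"
      by (intro sum.cong) auto
    then have "(\<Sum>r\<in>R. of_bool (r = r0) * b r) = b r0"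
      using r0 \<open>finite R\<close> by simp
    then show ?thesis using r0 by (intro disjI1 exI[of _ "\<lambda>r. of_bool (r = r0)"]) auto
  qed
next
  case (insert i S)
  let ?dot = "\<lambda>v y. \<Sum>r\<in>R. v r * y r"
  from insert.IH[of "x i"] show ?case
  proof (elim disjE exE conjE)
    fix t h assume t: "t \<noteq> 0" and th: "\<forall>r\<in>R. t * x i r = (\<Sum>j\<in>S. h j * x j r)"
    from insert.IH[of b] show ?thesis
    proof (elim disjE exE conjE)
      fix v assume v: "\<forall>j\<in>S. ?dot v (x j) = 0" "?dot v b \<noteq> 0"
      have "t * ?dot v (x i) = (\<Sum>r\<in>R. v r * (t * x i r))"
        by (simp add: sum_distrib_left algebra_simps)
      also have "\<dots> = (\<Sum>r\<in>R. \<Sum>j\<in>S. h j * (v r * x j r))"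
        using th by (simp add: sum_distrib_left algebra_simps)
      also have "\<dots> = (\<Sum>j\<in>S. h j * ?dot v (x j))"
        by (subst sum.swap) (simp add: sum_distrib_left)
      also have "\<dots> = 0" using v by simp
      finally have "?dot v (x i) = 0" using t by simp
      then show ?thesis using v by auto
    next
      fix t' h' assume t': "t' \<noteq> 0" "\<forall>r\<in>R. t' * b r = (\<Sum>j\<in>S. h' j * x j r)"
      have "(\<Sum>j\<in>insert i S. (h'(i := 0)) j * x j r) = (\<Sum>j\<in>S. h' j * x j r)" for r
        using insert.hyps by (auto intro!: sum.cong)
      then show ?thesis using t' by (intro disjI2 exI[of _ t'] exI[of _ "h'(i := 0)"]) simp
    qed
  next
    fix w assume w: "\<forall>j\<in>S. ?dot w (x j) = 0" "?dot w (x i) \<noteq> 0"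
    define \<alpha> where "\<alpha> = ?dot w (x i)"
    define \<gamma> where "\<gamma> = ?dot w b"
    from insert.IH[of "\<lambda>r. \<alpha> * b r - \<gamma> * x i r"] show ?thesis
    proof (elim disjE exE conjE)
      fix v assume v: "\<forall>j\<in>S. ?dot v (x j) = 0" "?dot v (\<lambda>r. \<alpha> * b r - \<gamma> * x i r) \<noteq> 0"
      define \<delta> where "\<delta> = ?dot v (x i)"
      have dot: "?dot (\<lambda>r. \<alpha> * v r - \<delta> * w r) y = \<alpha> * ?dot v y - \<delta> * ?dot w y" for y
        by (simp add: sum_distrib_left sum_subtractf algebra_simps)
      have "?dot v (\<lambda>r. \<alpha> * b r - \<gamma> * x i r) = \<alpha> * ?dot v b - \<delta> * \<gamma>"
        by (simp add: \<delta>_def sum_distrib_left sum_distrib_right sum_subtractf algebra_simps)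
      then have "?dot (\<lambda>r. \<alpha> * v r - \<delta> * w r) b \<noteq> 0"
        using v unfolding dot \<gamma>_def by simp
      moreover have "?dot (\<lambda>r. \<alpha> * v r - \<delta> * w r) (x j) = 0" if "j \<in> insert i S" for j
        using that v w unfolding dot by (auto simp: \<alpha>_def \<delta>_def)
      ultimately show ?thesis
        by (intro disjI1 exI[of _ "\<lambda>r. \<alpha> * v r - \<delta> * w r"] conjI ballI)
    next
      fix t h assume t: "t \<noteq> 0"
        and th: "\<forall>r\<in>R. t * (\<alpha> * b r - \<gamma> * x i r) = (\<Sum>j\<in>S. h j * x j r)"
      have "(\<Sum>j\<in>S. (h(i := t * \<gamma>)) j * x j r) = (\<Sum>j\<in>S. h j * x j r)" for r
        using insert.hyps by (auto intro!: sum.cong)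
      then have "t * \<alpha> * b r = (\<Sum>j\<in>insert i S. (h(i := t * \<gamma>)) j * x j r)" if "r \<in> R" for r
        using insert.hyps th that by (auto simp: algebra_simps)
      moreover have "t * \<alpha> \<noteq> 0" using t w by (simp add: \<alpha>_def)
      ultimately show ?thesis
        by (intro disjI2 exI[of _ "t * \<alpha>"] exI[of _ "h(i := t * \<gamma>)"] conjI ballI)
    qed
  qed
qed

lemma index_mult_mat_vec_sum:
  fixes A :: "int mat"
  assumes "u \<in> carrier_vec (dim_col A)" "r < dim_row A"
  shows "(A *\<^sub>v u) $ r = (\<Sum>k<dim_col A. A $$ (r, k) * u $ k)"
  using assms by (simp add: scalar_prod_def lessThan_atLeast0)

lemma index_covector_sum:
  fixes A :: "int mat"
  assumes "v \<in> carrier_vec (dim_row A)" "k < dim_col A"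
  shows "(transpose_mat A *\<^sub>v v) $ k = (\<Sum>r<dim_row A. v $ r * A $$ (r, k))"
  using assms by (simp add: scalar_prod_def lessThan_atLeast0 mult.commute)

lemma mult_mat_unit_vec:
  fixes A :: "int mat"
  assumes "j < dim_col A"
  shows "A *\<^sub>v unit_vec (dim_col A) j = col A j"
  using assms by (intro eq_vecI) auto

text \<open>
  Column \<open>k\<close> is tested against the other columns: a dependence with nonzero coefficient is a kernel
  vector, and a functional that separates column \<open>k\<close> from the others gives the covector.
\<close>

lemma kernel_vector_or_singleton_covector:
  assumes k: "k < dim_col A"
  shows "(\<exists>u\<in>mat_kernel A. u $ k \<noteq> 0) \<or> (\<exists>w\<in>covectors A. vec_support w = {k})"
proof -
  let ?S = "{..<dim_col A} - {k}"
  have split_k: "(\<Sum>j<dim_col A. f j) = f k + (\<Sum>j\<in>?S. f j)" for f :: "nat \<Rightarrow> int"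
    using k by (subst sum.remove[of _ k]) auto
  from separating_functional_or_relation[of "{..<dim_row A}" ?S "\<lambda>j r. A $$ (r, j)" "\<lambda>r. A $$ (r, k)"]
  consider (functional) v where "\<forall>j\<in>?S. (\<Sum>r<dim_row A. v r * A $$ (r, j)) = 0"
      "(\<Sum>r<dim_row A. v r * A $$ (r, k)) \<noteq> 0"
    | (relation) t h where "t \<noteq> 0"
      "\<forall>r<dim_row A. t * A $$ (r, k) = (\<Sum>j\<in>?S. h j * A $$ (r, j))"
    by fastforce
  then show ?thesis
  proof cases
    case functional
    let ?v = "vec (dim_row A) v"
    let ?w = "transpose_mat A *\<^sub>v ?v"
    have "?w $ j = (\<Sum>r<dim_row A. v r * A $$ (r, j))" if "j < dim_col A" for j
      using that by (subst index_covector_sum) auto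
    then have "vec_support ?w = {k}"
      using functional k unfolding vec_support_def by auto
    moreover have "?w \<in> covectors A" unfolding covectors_def by auto
    ultimately show ?thesis by blast
  next
    case relation
    let ?u = "vec (dim_col A) (\<lambda>j. if j = k then - t else h j)"
    have "(A *\<^sub>v ?u) $ r = 0" if r: "r < dim_row A" for r
    proof -
      have "(A *\<^sub>v ?u) $ r = (\<Sum>j<dim_col A. A $$ (r, j) * (if j = k then - t else h j))"
        using r by (subst index_mult_mat_vec_sum) auto
      also have "\<dots> = - (t * A $$ (r, k)) + (\<Sum>j\<in>?S. h j * A $$ (r, j))"
        unfolding split_k by (auto intro!: sum.cong)
      finally show ?thesis using relation r by simp
    qed
    then have "?u \<in> mat_kernel A"
      by (auto simp: mat_kernel_def intro!: eq_vecI)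
    moreover have "?u $ k \<noteq> 0" using k relation by simp
    ultimately show ?thesis by blast
  qed
qed

lemma free_col_if_singleton_covector:
  assumes w: "w \<in> covectors A" "vec_support w = {k}"
  shows "free_col A k"
proof -
  have "w \<noteq> 0\<^sub>v (dim_col A)"
  proof
    assume "w = 0\<^sub>v (dim_col A)"
    then have "vec_support w = {}" by (simp add: vec_support_def)
    then show False using w by simp
  qed
  moreover have "w' = 0\<^sub>v (dim_col A)" if "w' \<in> covectors A" "vec_support w' \<subset> {k}" for w'
  proof -
    have "vec_support w' = {}" using that by blast
    moreover have "dim_vec w' = dim_col A" using that by (auto simp: covectors_def)
    ultimately show ?thesis by (auto simp: vec_support_def intro!: eq_vecI)
  qed
  ultimately show ?thesis
    unfolding free_col_def cocircuit_def using w by blast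
qed

text \<open>
  Some kernel vector is nonzero at \<open>k\<close>, and it is a combination of the columns of \<open>G\<close>. This is one half
  of the characterisation of free vectors as those with zero Gale transform.
\<close>

lemma gale_row_nonzero_if_not_free:
  assumes G: "gale_matrix A G" and k: "k < dim_col A" and nonfree: "\<not> free_col A k"
  shows "\<exists>j<dim_col G. G $$ (k, j) \<noteq> 0"
proof -
  obtain u where u: "u \<in> mat_kernel A" "u $ k \<noteq> 0"
    using kernel_vector_or_singleton_covector[OF k] free_col_if_singleton_covector nonfree by blast
  then obtain x where x: "x \<in> carrier_vec (dim_col G)" "u = G *\<^sub>v x"
    using G by (auto simp: gale_matrix_def bij_betw_def)
  have "k < dim_row G" using G k by (simp add: gale_matrix_def)
  then have "(\<Sum>j<dim_col G. G $$ (k, j) * x $ j) \<noteq> 0"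
    using u x index_mult_mat_vec_sum[of x G k] by simp
  then obtain j where "j < dim_col G" "G $$ (k, j) * x $ j \<noteq> 0"
    using sum.not_neutral_contains_not_neutral by (metis (no_types, lifting) lessThan_iff)
  then show ?thesis by auto
qed

lemma gale_col_in_kernel:
  assumes G: "gale_matrix A G" and j: "j < dim_col G"
  shows "col G j \<in> mat_kernel A"
proof -
  have "G *\<^sub>v unit_vec (dim_col G) j = col G j"
    using j by (rule mult_mat_unit_vec)
  moreover have "G *\<^sub>v unit_vec (dim_col G) j \<in> mat_kernel A"
    using G by (intro bij_betwE[THEN bspec, of "\<lambda>x. G *\<^sub>v x"]) (auto simp: gale_matrix_def)
  ultimately show ?thesis by simp
qed

section \<open>The glued matrix\<close>

text \<open>
  The blocks are described by the map \<open>bl\<close> from column indices to block numbers, and \<open>st i\<close> is the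
  leading index of block \<open>i\<close>. The vectors \<open>c\<^sub>i\<close> are put side by side into one sequence \<open>C\<close>, with
  Bezout coefficients \<open>L\<close>. The lower rows belong to the non-leading columns, and their order is
  immaterial, so an arbitrary enumeration \<open>d\<close> of these columns avoids any arithmetic on row indices.
\<close>

locale bouquet_gluing =
  fixes m s q :: nat and bl st d :: "nat \<Rightarrow> nat" and N :: nat
    and a :: "nat \<Rightarrow> int vec" and C L :: "nat \<Rightarrow> int"
  assumes bl: "k < q \<Longrightarrow> bl k < s"
    and st: "i < s \<Longrightarrow> st i < q" "i < s \<Longrightarrow> bl (st i) = i"
    and st_le: "k < q \<Longrightarrow> st (bl k) \<le> k"
    and a_carrier: "i < s \<Longrightarrow> a i \<in> carrier_vec m"
    and C_nonzero: "k < q \<Longrightarrow> C k \<noteq> 0"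
    and C_st: "i < s \<Longrightarrow> C (st i) > 0"
    and bezout: "i < s \<Longrightarrow> (\<Sum>k | k < q \<and> bl k = i. L k * C k) = 1"
    and d: "bij_betw d {..<N} {k. k < q \<and> k \<noteq> st (bl k)}"
begin

definition block :: "nat \<Rightarrow> nat set" where
  "block i = {k. k < q \<and> bl k = i}"

definition glued :: "int mat" where
  "glued = mat (m + N) q (\<lambda>(r, k).
     if r < m then L k * a (bl k) $ r
     else let e = d (r - m) in
       if k = e then C (st (bl e)) else if k = st (bl e) then - C e else 0)"

definition block_vec :: "nat \<Rightarrow> int vec" where
  "block_vec i = vec q (\<lambda>k. if bl k = i then C k else 0)"

lemma glued_dim [simp]: "dim_row glued = m + N" "dim_col glued = q"
  by (simp_all add: glued_def)

lemma finite_block [simp]: "finite (block i)"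
  by (simp add: block_def)

lemma st_in_block: "i < s \<Longrightarrow> st i \<in> block i"
  by (simp add: block_def st)

lemma Min_block: "i < s \<Longrightarrow> Min (block i) = st i"
  using st_in_block st_le by (intro Min_eqI) (auto simp: block_def)

lemma bezout_block: "i < s \<Longrightarrow> (\<Sum>k\<in>block i. L k * C k) = 1"
  using bezout by (simp add: block_def)

lemma row_of_column:
  assumes "e < q" "e \<noteq> st (bl e)"
  obtains r where "r < N" "d r = e"
proof -
  have "e \<in> d ` {..<N}" using d assms by (simp add: bij_betw_def)
  then show ?thesis using that by blast
qed

lemma column_of_row:
  assumes "r < N"
  shows "d r < q" "d r \<noteq> st (bl (d r))"
  using bij_betwE[OF d] assms by auto

lemma glued_lower:
  assumes "r < N" "k < q"
  shows "glued $$ (m + r, k) = (if k = d r then C (st (bl (d r))) else 0)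
    + (if k = st (bl (d r)) then - C (d r) else 0)"
  using assms column_of_row[of r] by (auto simp: glued_def Let_def)

lemma glued_mult_lower:
  assumes u: "u \<in> carrier_vec q" and r: "r < N"
  shows "(glued *\<^sub>v u) $ (m + r) =
    C (st (bl (d r))) * u $ (d r) - C (d r) * u $ (st (bl (d r)))"
proof -
  let ?e = "d r"
  have e: "?e < q" "st (bl ?e) < q" using r column_of_row bl st by auto
  have "(glued *\<^sub>v u) $ (m + r) = (\<Sum>k<q. glued $$ (m + r, k) * u $ k)"
    using u r by (subst index_mult_mat_vec_sum) auto
  also have "\<dots> = (\<Sum>k<q. (if k = ?e then C (st (bl ?e)) * u $ k else 0)
      + (if k = st (bl ?e) then - C ?e * u $ k else 0))"
    using r by (intro sum.cong refl) (simp only: lessThan_iff glued_lower, simp add: distrib_right)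
  also have "\<dots> = C (st (bl ?e)) * u $ ?e - C ?e * u $ (st (bl ?e))"
    using e by (simp add: sum.distrib)
  finally show ?thesis .
qed

lemma covector_lower:
  assumes e: "e < q" "e \<noteq> st (bl e)"
  shows "\<exists>v\<in>carrier_vec (m + N). \<forall>k<q. (transpose_mat glued *\<^sub>v v) $ k =
    (if k = e then C (st (bl e)) else if k = st (bl e) then - C e else 0)"
proof -
  obtain r where r: "r < N" "d r = e" using row_of_column e by blast
  let ?v = "unit_vec (m + N) (m + r) :: int vec"
  have "(transpose_mat glued *\<^sub>v ?v) $ k = glued $$ (m + r, k)" if "k < q" for k
  proof -
    have "transpose_mat glued *\<^sub>v ?v = col (transpose_mat glued) (m + r)"
      using r mult_mat_unit_vec[of "m + r" "transpose_mat glued"] by simp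
    then show ?thesis using r that by simp
  qed
  then show ?thesis using r e by (intro bexI[of _ ?v]) (auto simp: glued_lower)
qed

text \<open>
  If \<open>l\<close> is the leading index, the lower row of \<open>k\<close> itself serves. Otherwise both lower rows are
  combined so that their entries at the leading index, \<open>- C k\<close> and \<open>- C l\<close>, cancel.
\<close>

lemma covector_pair:
  assumes k: "k \<in> block i" and l: "l \<in> block i" and kl: "k \<noteq> l" "k \<noteq> st i"
  shows "\<exists>w\<in>covectors glued. vec_support w = {k, l}"
proof -
  let ?w = "\<lambda>v. transpose_mat glued *\<^sub>v v"
  have i: "i < s" and kq: "k < q" "bl k = i" and lq: "l < q" "bl l = i"
    using k l bl by (auto simp: block_def)
  have C: "C (st i) \<noteq> 0" "C k \<noteq> 0" "C l \<noteq> 0" using C_st[OF i] C_nonzero kq lq by auto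
  obtain v where v: "v \<in> carrier_vec (m + N)"
    "\<And>x. x < q \<Longrightarrow> ?w v $ x = (if x = k then C (st i) else if x = st i then - C k else 0)"
    using covector_lower[of k] kq kl by auto
  show ?thesis
  proof (cases "l = st i")
    case True
    have "vec_support (?w v) = {k, l}"
      using v(2) kq lq C kl True by (auto simp: vec_support_def split: if_splits)
    moreover have "?w v \<in> covectors glued" using v(1) by (auto simp: covectors_def)
    ultimately show ?thesis by blast
  next
    case False
    then obtain v' where v': "v' \<in> carrier_vec (m + N)"
      "\<And>x. x < q \<Longrightarrow> ?w v' $ x = (if x = l then C (st i) else if x = st i then - C l else 0)"
      using covector_lower[of l] lq by auto
    let ?z = "C l \<cdot>\<^sub>v v - C k \<cdot>\<^sub>v v'"
    have "?w ?z $ x = C l * ?w v $ x - C k * ?w v' $ x" if "x < q" for x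
      using that v(1) v'(1)
      by (subst (1 2 3) index_covector_sum) (auto simp: sum_distrib_left sum_subtractf algebra_simps)
    then have "vec_support (?w ?z) = {k, l}"
      using v(2) v'(2) kq lq C kl False by (auto simp: vec_support_def split: if_splits)
    moreover have "?w ?z \<in> covectors glued" using v(1) v'(1) by (auto simp: covectors_def)
    ultimately show ?thesis by blast
  qed
qed

lemma subbouquet_block:
  assumes i: "i < s"
  shows "subbouquet glued (block i)"
proof -
  have "bouquet_edge glued k l" if "k \<in> block i" "l \<in> block i" "k \<noteq> l" for k l
    unfolding bouquet_edge_def
    using that covector_pair[of k i l] covector_pair[of l i k]
    by (cases "k = st i") (auto simp: insert_commute)
  then show ?thesis
    using st_in_block[OF i] by (auto simp: subbouquet_def pairwise_def block_def)
qed

lemma subbouquet_decomposition_block: "subbouquet_decomposition glued s block"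
  using subbouquet_block bl
  by (auto simp: subbouquet_decomposition_def disjoint_family_on_def block_def)

text \<open>
  The proportionality given by the lower rows only yields a rational factor \<open>u $ st i / C (st i)\<close>.
  Weighting the entries of \<open>u\<close> with the Bezout coefficients exhibits it as the integer
  \<open>\<Sum>k\<in>block i. L k * u $ k\<close>.
\<close>

lemma kernel_block_multiple:
  assumes u: "u \<in> mat_kernel glued" and i: "i < s"
  shows "\<exists>t. \<forall>k\<in>block i. u $ k = t * C k"
proof -
  have uc: "u \<in> carrier_vec q" and u0: "glued *\<^sub>v u = 0\<^sub>v (m + N)"
    using u by (auto simp: mat_kernel_def)
  have ratio: "C (st i) * u $ k = C k * u $ (st i)" if "k \<in> block i" for k
  proof (cases "k = st i")
    case False
    have k: "k < q" "bl k = i" using that by (auto simp: block_def)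
    then obtain r where r: "r < N" "d r = k" using row_of_column False by metis
    then show ?thesis using glued_mult_lower[OF uc r(1)] u0 k by simp
  qed simp
  let ?t = "\<Sum>k\<in>block i. L k * u $ k"
  have "C (st i) * ?t = (\<Sum>k\<in>block i. L k * (C (st i) * u $ k))"
    by (simp add: sum_distrib_left algebra_simps)
  also have "\<dots> = (\<Sum>k\<in>block i. L k * C k) * u $ (st i)"
    by (auto simp: ratio sum_distrib_right intro!: sum.cong)
  finally have t: "C (st i) * ?t = u $ (st i)" using bezout_block[OF i] by simp
  have "u $ k = ?t * C k" if "k \<in> block i" for k
  proof -
    have "C (st i) * u $ k = C (st i) * (?t * C k)"
      using ratio[OF that] t[symmetric] by (simp add: algebra_simps)
    then show ?thesis using C_st[OF i] by simp
  qed
  then show ?thesis by blast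
qed

lemma GCD_block_multiple:
  assumes i: "i < s"
  shows "(GCD k\<in>block i. t * C k) = \<bar>t\<bar>"
proof -
  let ?g = "GCD k\<in>block i. t * C k"
  have "\<bar>t\<bar> dvd ?g" by (intro Gcd_greatest) auto
  moreover have "?g dvd (\<Sum>k\<in>block i. L k * (t * C k))"
    by (intro dvd_sum dvd_mult Gcd_dvd) auto
  moreover have "(\<Sum>k\<in>block i. L k * (t * C k)) = t * (\<Sum>k\<in>block i. L k * C k)"
    by (simp add: sum_distrib_left algebra_simps)
  ultimately have "?g dvd \<bar>t\<bar>" "\<bar>t\<bar> dvd ?g" using bezout_block[OF i] by auto
  then show ?thesis by (intro zdvd_antisym_nonneg) auto
qed

lemma vec_support_block_vec: "vec_support (block_vec i) = block i"
  using C_nonzero by (auto simp: vec_support_def block_vec_def block_def split: if_splits)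

lemma glued_mult_block_vec:
  assumes i: "i < s"
  shows "glued *\<^sub>v block_vec i = a i @\<^sub>v 0\<^sub>v N"
proof (rule eq_vecI)
  have ai: "dim_vec (a i) = m" using a_carrier[OF i] by auto
  have bc: "block_vec i \<in> carrier_vec q" by (simp add: block_vec_def)
  show "dim_vec (glued *\<^sub>v block_vec i) = dim_vec (a i @\<^sub>v 0\<^sub>v N)" using ai by simp
  fix r assume "r < dim_vec (a i @\<^sub>v 0\<^sub>v N)"
  then have r: "r < m + N" using ai by simp
  show "(glued *\<^sub>v block_vec i) $ r = (a i @\<^sub>v 0\<^sub>v N) $ r"
  proof (cases "r < m")
    case True
    have "(glued *\<^sub>v block_vec i) $ r = (\<Sum>k<q. if bl k = i then L k * C k * a i $ r else 0)"
      using bc True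
      by (subst index_mult_mat_vec_sum) (auto simp: glued_def block_vec_def intro!: sum.cong)
    also have "\<dots> = (\<Sum>k\<in>block i. L k * C k) * a i $ r"
      unfolding sum_distrib_right block_def by (simp add: sum.If_cases Int_def)
    finally show ?thesis using bezout_block[OF i] True ai by simp
  next
    case False
    then obtain r' where r': "r = m + r'" "r' < N" using r by (metis add_less_cancel_left le_Suc_ex not_less)
    then show ?thesis
      using glued_mult_lower[OF bc r'(2)] column_of_row[OF r'(2)] bl st ai
      by (auto simp: block_vec_def)
  qed
qed

text \<open>
  In the free case any vector with the right support and sign is admissible. In the non-free case a
  column of \<open>G\<close> that is nonzero at one index of the block is a nonzero multiple \<open>t\<close> of \<open>C\<close> on the whole
  block; as \<open>C\<close> is positive at the leading index, the sign prescribed by the encoding is that of \<open>t\<close>.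
\<close>

lemma encoded_by_block:
  assumes i: "i < s" and G: "gale_matrix glued G"
  shows "encoded_by glued G (block i) (a i @\<^sub>v 0\<^sub>v N) (block_vec i)"
proof (cases "free_subbouquet glued (block i)")
  case True
  have "block_vec i $ Min (block i) > 0"
    using st C_st i by (simp add: Min_block block_vec_def)
  then show ?thesis
    using True glued_mult_block_vec[OF i] vec_support_block_vec
    by (auto simp: encoded_by_def block_vec_def)
next
  case False
  then obtain k where k: "k \<in> block i" "\<not> free_col glued k"
    using subbouquet_block[OF i] by (auto simp: free_subbouquet_def)
  then have kq: "k < dim_col glued" by (simp add: block_def)
  obtain j where j: "j < dim_col G" "G $$ (k, j) \<noteq> 0"
    using gale_row_nonzero_if_not_free[OF G kq k(2)] by blast
  obtain t where t0: "\<And>l. l \<in> block i \<Longrightarrow> col G j $ l = t * C l"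
    using kernel_block_multiple[OF gale_col_in_kernel[OF G j(1)] i] by blast
  have t: "G $$ (l, j) = t * C l" if "l \<in> block i" for l
    using t0[OF that] that G j by (simp add: gale_matrix_def block_def)
  have tn: "t \<noteq> 0" using t[OF k(1)] j by auto
  have nz: "\<forall>l\<in>block i. G $$ (l, j) \<noteq> 0"
    using t tn C_nonzero by (auto simp: block_def)
  have gcd: "(GCD l\<in>block i. G $$ (l, j)) = \<bar>t\<bar>"
    using GCD_block_multiple[OF i, of t] t by (simp cong: image_cong)
  have sgn: "sgn (G $$ (Min (block i), j)) = sgn t"
    using t[OF st_in_block[OF i]] C_st[OF i] by (simp add: Min_block[OF i] sgn_mult)
  have "sgn t * (t * c div \<bar>t\<bar>) = c" for c :: int
  proof -
    have "t * c = \<bar>t\<bar> * (sgn t * c)" by (simp add: mult.assoc[symmetric] abs_mult_sgn)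
    then have "t * c div \<bar>t\<bar> = sgn t * c" using tn by (metis abs_eq_0 nonzero_mult_div_cancel_left)
    then show ?thesis using tn by (simp add: mult.assoc[symmetric] sgn_mult_self_eq)
  qed
  then have "block_vec i = vec q (\<lambda>l. if l \<in> block i
      then sgn (G $$ (Min (block i), j)) * (G $$ (l, j) div (GCD l\<in>block i. G $$ (l, j))) else 0)"
    unfolding gcd sgn by (intro eq_vecI) (auto simp: t block_vec_def, auto simp: block_def)
  then show ?thesis
    using False glued_mult_block_vec[OF i] j nz by (auto simp: encoded_by_def block_vec_def)
qed

end

section \<open>Consecutive blocks\<close>

lemma block_index_exists:
  fixes n :: "nat \<Rightarrow> nat"
  assumes "k < (\<Sum>j<s. n j)"
  shows "\<exists>i<s. (\<Sum>j<i. n j) \<le> k \<and> k < (\<Sum>j<i. n j) + n i"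
  using assms
proof (induction s)
  case (Suc s)
  then show ?case
    by (cases "k < (\<Sum>j<s. n j)") (auto simp: less_Suc_eq)
qed simp

lemma block_index_unique:
  fixes n :: "nat \<Rightarrow> nat"
  assumes "(\<Sum>j<i. n j) \<le> k" "k < (\<Sum>j<i. n j) + n i"
    and "(\<Sum>j<i'. n j) \<le> k" "k < (\<Sum>j<i'. n j) + n i'"
  shows "i = i'"
proof -
  have mono: "(\<Sum>j<Suc x. n j) \<le> (\<Sum>j<y. n j)" if "x < y" for x y
    using that by (intro sum_mono2) auto
  show ?thesis using mono[of i i'] mono[of i' i] assms by (cases i i' rule: linorder_cases) auto
qed

theorem theoremB:
  fixes m s p q :: nat
    and n :: "nat \<Rightarrow> nat"
    and a c :: "nat \<Rightarrow> int vec"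
  assumes "\<And>i. i < s \<Longrightarrow> a i \<in> carrier_vec m"
    and "\<And>i. i < s \<Longrightarrow> n i \<ge> 1"
    and "\<And>i. i < s \<Longrightarrow> c i \<in> carrier_vec (n i)"
    and "\<And>i. i < s \<Longrightarrow> primitive_vec (c i)"
    and "\<And>i. i < s \<Longrightarrow> full_support (c i)"
    and "\<And>i. i < s \<Longrightarrow> c i $ 0 > 0"
    and "p = m + (\<Sum>i<s. n i - 1)"
    and "q = (\<Sum>i<s. n i)"
  shows "\<exists>A \<in> carrier_mat p q. \<exists>B. subbouquet_decomposition A s B \<and>
    (\<forall>i<s.
      let aB = a i @\<^sub>v 0\<^sub>v (\<Sum>j<s. n j - 1);
          cB = 0\<^sub>v (\<Sum>j<i. n j) @\<^sub>v c i @\<^sub>v 0\<^sub>v (\<Sum>j\<in>{i<..<s}. n j)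
      in vec_support cB = {(\<Sum>j<i. n j) ..< (\<Sum>j<i. n j) + n i} \<and>
         (\<forall>G. gale_matrix A G \<longrightarrow> encoded_by A G (B i) aB cB))"
proof -
  define st where "st i = (\<Sum>j<i. n j)" for i
  define bl where "bl k = (SOME i. i < s \<and> st i \<le> k \<and> k < st i + n i)" for k
  define N where "N = (\<Sum>j<s. n j - 1)"
  note n = assms(2)
  have dim_c: "dim_vec (c i) = n i" if "i < s" for i
    using assms(3)[OF that] by auto
  have bl_bounds: "bl k < s" "st (bl k) \<le> k" "k < st (bl k) + n (bl k)" if "k < q" for k
    using someI_ex[of "\<lambda>i. i < s \<and> st i \<le> k \<and> k < st i + n i"] block_index_exists[of k n s] that
    by (auto simp: bl_def st_def assms(8))
  have total: "q = st i + n i + (\<Sum>j\<in>{i<..<s}. n j)" if "i < s" for i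
  proof -
    have "{..<s} = {..<Suc i} \<union> {i<..<s}" using that by auto
    then have "q = (\<Sum>j<Suc i. n j) + (\<Sum>j\<in>{i<..<s}. n j)"
      unfolding assms(8) by (metis (no_types, lifting) finite_greaterThanLessThan finite_lessThan
          sum.union_disjoint disjoint_iff greaterThanLessThan_iff lessThan_iff less_SucE less_asym less_irrefl)
    then show ?thesis by (simp add: st_def)
  qed
  have bl_eq: "bl k = i" if "i < s" "st i \<le> k" "k < st i + n i" for i k
  proof -
    have "k < q" using total[OF that(1)] that by simp
    then show ?thesis using block_index_unique[of n "bl k" k i] bl_bounds[of k] that by (simp add: st_def)
  qed
  have block: "{k. k < q \<and> bl k = i} = {st i..<st i + n i}" if "i < s" for i
    using that bl_bounds bl_eq total[OF that] by auto
  have st_in: "st i < q" "bl (st i) = i" if "i < s" for i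
    using that bl_eq[of i "st i"] n[OF that] total[OF that] by auto

  have "\<exists>g. (\<Sum>l<n i. g l * c i $ l) = 1" if "i < s" for i
    using GCD_eq_int_combination[of "{..<n i}" "\<lambda>l. c i $ l"] assms(4)[OF that] dim_c[OF that]
    by (simp add: primitive_vec_def)
  then obtain g where g: "\<And>i. i < s \<Longrightarrow> (\<Sum>l<n i. g i l * c i $ l) = 1" by metis
  define C where "C k = c (bl k) $ (k - st (bl k))" for k
  define L where "L k = g (bl k) (k - st (bl k))" for k

  let ?D = "{k. k < q \<and> k \<noteq> st (bl k)}"
  \<comment> \<open>The lower part has exactly as many rows as there are non-leading columns.\<close>
  have "?D = {..<q} - st ` {..<s}" using st_in bl_bounds by auto
  moreover have "inj_on st {..<s}" using st_in by (metis inj_onI lessThan_iff)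
  ultimately have "card ?D = q - s" using st_in by (subst (asm) eq_commute)
      (auto simp: card_Diff_subset card_image image_subset_iff)
  moreover have "N + s = q"
  proof -
    have "N + s = (\<Sum>j<s. (n j - 1) + 1)" unfolding sum.distrib by (simp add: N_def)
    also have "\<dots> = q" unfolding assms(8) using n by (intro sum.cong refl) (simp del: One_nat_def)
    finally show ?thesis .
  qed
  ultimately have "card {..<N} = card ?D" by simp
  then obtain d where d: "bij_betw d {..<N} ?D"
    using finite_same_card_bij[of "{..<N}" ?D] by auto

  interpret bouquet_gluing m s q bl st d N a C L
  proof
    fix i assume i: "i < s"
    show "(\<Sum>k | k < q \<and> bl k = i. L k * C k) = 1"
    proof -
      have "(\<Sum>k | k < q \<and> bl k = i. L k * C k) = (\<Sum>k\<in>{st i..<st i + n i}. g i (k - st i) * c i $ (k - st i))"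
        unfolding block[OF i] using bl_eq[OF i] by (intro sum.cong) (auto simp: L_def C_def)
      also have "\<dots> = (\<Sum>l<n i. g i l * c i $ l)"
        by (rule sum.reindex_bij_witness[of _ "\<lambda>l. st i + l" "\<lambda>k. k - st i"]) auto
      finally show ?thesis using g[OF i] by simp
    qed
    show "C (st i) > 0" using st_in[OF i] assms(6)[OF i] by (simp add: C_def)
  next
    fix k assume "k < q"
    then show "C k \<noteq> 0"
      using bl_bounds[of k] assms(5)[of "bl k"] dim_c[of "bl k"] by (auto simp: C_def full_support_def)
  qed (use bl_bounds st_in assms(1) d in auto)

  show ?thesis
  proof (intro bexI[of _ glued] exI[of _ block] conjI allI impI)
    show "glued \<in> carrier_mat p q"
      unfolding assms(7) N_def[symmetric] by (intro carrier_matI glued_dim)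
    show "subbouquet_decomposition glued s block" by (rule subbouquet_decomposition_block)
    fix i assume i: "i < s"
    have cB: "0\<^sub>v (st i) @\<^sub>v c i @\<^sub>v 0\<^sub>v (\<Sum>j\<in>{i<..<s}. n j) = block_vec i"
    proof (rule eq_vecI)
      fix k assume "k < dim_vec (block_vec i)"
      then have k: "k < q" by (simp add: block_vec_def)
      have "bl k = i \<longleftrightarrow> st i \<le> k \<and> k < st i + n i" using bl_bounds[OF k] bl_eq[OF i] by auto
      moreover have "block_vec i $ k = (if bl k = i then C k else 0)"
        using k by (simp add: block_vec_def)
      moreover have "k < st i + n i + (\<Sum>j\<in>{i<..<s}. n j)" using k total[OF i] by simp
      ultimately show
        "(0\<^sub>v (st i) @\<^sub>v c i @\<^sub>v 0\<^sub>v (\<Sum>j\<in>{i<..<s}. n j)) $ k = block_vec i $ k"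
        using dim_c[OF i] by (auto simp: C_def)
    next
      have "dim_vec (block_vec i) = q" by (simp add: block_vec_def)
      then show "dim_vec (0\<^sub>v (st i) @\<^sub>v c i @\<^sub>v 0\<^sub>v (\<Sum>j\<in>{i<..<s}. n j)) = dim_vec (block_vec i)"
        using total[OF i] dim_c[OF i] by simp
    qed
    have "vec_support (block_vec i) = {st i..<st i + n i}"
      unfolding vec_support_block_vec block_def by (rule block[OF i])
    then show "let aB = a i @\<^sub>v 0\<^sub>v (\<Sum>j<s. n j - 1);
          cB = 0\<^sub>v (\<Sum>j<i. n j) @\<^sub>v c i @\<^sub>v 0\<^sub>v (\<Sum>j\<in>{i<..<s}. n j)
      in vec_support cB = {(\<Sum>j<i. n j) ..< (\<Sum>j<i. n j) + n i} \<and>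
         (\<forall>G. gale_matrix glued G \<longrightarrow> encoded_by glued G (block i) aB cB)"
      unfolding Let_def st_def[symmetric] N_def[symmetric] cB
      using encoded_by_block[OF i] by blast
  qed
qed

end
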